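(* The number $f_{\mathrm{kei}}(n)$ of isomorphism classes of kei of order $n$ is at least $2^{\frac{1}{4}n^2-O(n\log n)}$; that is, there exists a constant $C>0$ such that $f_{\mathrm{kei}}(n)\geq 2^{\frac14 n^2-Cn\log n}$ for all sufficiently large integers $n$.
   Context: A rack is a set $X$ together with a binary operation $\vartriangleright:X\times X\to X$ such that (i) for all $y\in X$ the map $f_y:X\to X$, $x\mapsto x\vartriangleright y$, is a bijection; and (ii) for all $x,y,z\in X$, $(x\vartriangleright y)\vartriangleright z=(x\vartriangleright z)\vartriangleright(y\vartriangleright z)$. A quandle is a rack such that $x\vartriangleright x=x$ for all $x\in X$. A kei is a quandle such that for every $y\in X$ the permutation $f_y$ has order dividing $2$ (i.e. $f_y\circ f_y$ is the identity). An isomorphism from $(X,\vartriangleright)$ to $(X',\vartriangleright')$ is a bijection $\theta:X\to X'$ such that $\theta(x)\vartriangleright'\theta(y)=\theta(x\vartriangleright y)$ for all $x,y\in X$. A kei has order $n$ if its underlying set is finite of cardinality $n$. *)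

theory Defs
  imports Complex_Main
begin

locale rack =
  fixes X :: "'a set" and rop :: "'a \<Rightarrow> 'a \<Rightarrow> 'a"  (infixl "\<rhd>" 70)
  assumes closed: "\<lbrakk>x \<in> X; y \<in> X\<rbrakk> \<Longrightarrow> x \<rhd> y \<in> X"
    and bij: "y \<in> X \<Longrightarrow> bij_betw (\<lambda>x. x \<rhd> y) X X"
    and distrib: "\<lbrakk>x \<in> X; y \<in> X; z \<in> X\<rbrakk> \<Longrightarrow> (x \<rhd> y) \<rhd> z = (x \<rhd> z) \<rhd> (y \<rhd> z)"

locale quandle = rack +
  assumes idem: "x \<in> X \<Longrightarrow> x \<rhd> x = x"

locale kei = quandle +
  assumes involutory: "\<lbrakk>x \<in> X; y \<in> X\<rbrakk> \<Longrightarrow> (x \<rhd> y) \<rhd> y = x"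

definition rack_iso ::
  "('a \<Rightarrow> 'b) \<Rightarrow> 'a set \<Rightarrow> ('a \<Rightarrow> 'a \<Rightarrow> 'a) \<Rightarrow> 'b set \<Rightarrow> ('b \<Rightarrow> 'b \<Rightarrow> 'b) \<Rightarrow> bool" where
  "rack_iso \<theta> X f X' g \<longleftrightarrow>
     bij_betw \<theta> X X' \<and> (\<forall>x\<in>X. \<forall>y\<in>X. g (\<theta> x) (\<theta> y) = \<theta> (f x y))"

text \<open>
  Kei of order \<open>n\<close> are represented with carriers that are sets of natural numbers;
  every finite kei is isomorphic to one of these (\<open>kei_iso_nat\<close> below). The values of the
  operation outside the carrier are unconstrained, which does not affect the number of
  isomorphism classes, because isomorphisms only see the values on the carrier.
\<close>

definition keis :: "nat \<Rightarrow> (nat set \<times> (nat \<Rightarrow> nat \<Rightarrow> nat)) set" where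
  "keis n = {(X, f). kei X f \<and> finite X \<and> card X = n}"

definition kei_iso_rel :: "nat \<Rightarrow> (nat set \<times> (nat \<Rightarrow> nat \<Rightarrow> nat)) rel" where
  "kei_iso_rel n =
     {((X, f), (X', g)). (X, f) \<in> keis n \<and> (X', g) \<in> keis n \<and> (\<exists>\<theta>. rack_iso \<theta> X f X' g)}"

definition f_kei :: "nat \<Rightarrow> nat" where
  "f_kei n = card (keis n // kei_iso_rel n)"

lemma rack_iso_refl: "rack_iso id X f X f"
  by (simp add: rack_iso_def)

lemma rack_iso_sym:
  assumes "rack X f" "rack_iso \<theta> X f X' g"
  shows "rack_iso (inv_into X \<theta>) X' g X f"
proof -
  have b: "bij_betw \<theta> X X'"
    and h: "\<And>x y. x \<in> X \<Longrightarrow> y \<in> X \<Longrightarrow> g (\<theta> x) (\<theta> y) = \<theta> (f x y)"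
    using assms(2) by (auto simp: rack_iso_def)
  have "f (inv_into X \<theta> u) (inv_into X \<theta> v) = inv_into X \<theta> (g u v)"
    if "u \<in> X'" "v \<in> X'" for u v
  proof -
    have u: "inv_into X \<theta> u \<in> X" and v: "inv_into X \<theta> v \<in> X"
      using b that by (auto simp: bij_betw_def inv_into_into)
    have "g u v = \<theta> (f (inv_into X \<theta> u) (inv_into X \<theta> v))"
      using h[OF u v] b that by (simp add: bij_betw_inv_into_right)
    then show ?thesis
      using rack.closed[OF assms(1) u v] b by (simp add: bij_betw_inv_into_left)
  qed
  then show ?thesis
    using b by (simp add: rack_iso_def bij_betw_inv_into)
qed

lemma rack_iso_trans:
  assumes "rack_iso \<theta> X f X' g" "rack_iso \<eta> X' g X'' h"
  shows "rack_iso (\<eta> \<circ> \<theta>) X f X'' h"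
proof -
  have "\<theta> x \<in> X'" if "x \<in> X" for x
    using assms(1) that by (auto simp: rack_iso_def bij_betw_def)
  then show ?thesis
    using assms by (auto simp: rack_iso_def intro: bij_betw_trans)
qed

lemma kei_is_rack: "kei X f \<Longrightarrow> rack X f"
  by (simp add: kei_def quandle_def)

lemma equiv_kei_iso_rel: "equiv (keis n) (kei_iso_rel n)"
proof (rule equivI)
  show "kei_iso_rel n \<subseteq> keis n \<times> keis n"
    by (auto simp: kei_iso_rel_def)
  show "refl_on (keis n) (kei_iso_rel n)"
    by (auto simp: refl_on_def kei_iso_rel_def intro: rack_iso_refl)
  show "sym (kei_iso_rel n)"
    by (auto simp: sym_def kei_iso_rel_def keis_def intro: rack_iso_sym kei_is_rack)
  show "trans (kei_iso_rel n)"
    by (auto simp: trans_def kei_iso_rel_def intro: rack_iso_trans)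
qed

lemma kei_transport:
  assumes "kei X f" "bij_betw \<theta> X X'"
  defines "g \<equiv> \<lambda>u v. if u \<in> X' \<and> v \<in> X' then \<theta> (f (inv_into X \<theta> u) (inv_into X \<theta> v)) else undefined"
  shows "kei X' g" "rack_iso \<theta> X f X' g"
proof -
  interpret kei X f by fact
  have im: "X' = \<theta> ` X" and inj: "inj_on \<theta> X"
    using assms(2) by (auto simp: bij_betw_def)
  have g: "g (\<theta> x) (\<theta> y) = \<theta> (f x y)" if "x \<in> X" "y \<in> X" for x y
    using that inj by (simp add: g_def im)
  show "rack_iso \<theta> X f X' g"
    using assms(2) g by (simp add: rack_iso_def)
  have inv: "g (g u v) v = u" if "u \<in> X'" "v \<in> X'" for u v
    using that by (auto simp: im g closed involutory)
  have cl: "g u v \<in> X'" if "u \<in> X'" "v \<in> X'" for u v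
    using that by (auto simp: im g closed)
  show "kei X' g"
  proof unfold_locales
    show "bij_betw (\<lambda>u. g u v) X' X'" if "v \<in> X'" for v
      using that by (intro bij_betw_byWitness[where f' = "\<lambda>u. g u v"]) (auto simp: inv cl)
    show "g (g u v) w = g (g u w) (g v w)" if "u \<in> X'" "v \<in> X'" "w \<in> X'" for u v w
    proof -
      obtain x y z where "u = \<theta> x" "v = \<theta> y" "w = \<theta> z" and X: "x \<in> X" "y \<in> X" "z \<in> X"
        using \<open>u \<in> X'\<close> \<open>v \<in> X'\<close> \<open>w \<in> X'\<close> by (auto simp: im)
      then show ?thesis
        using distrib[OF X] by (simp add: g closed)
    qed
    show "g u u = u" if "u \<in> X'" for u
      using that by (auto simp: im g idem)
  qed (auto simp: cl inv)
qed

lemma kei_iso_nat: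
  assumes "kei X f" "finite X" "card X = n"
  shows "\<exists>(X', g) \<in> keis n. \<exists>\<theta>. rack_iso \<theta> X f X' g"
proof -
  obtain \<theta> where "bij_betw \<theta> X {..<n}"
    using ex_bij_betw_finite_nat[OF assms(2)] assms(3) by (auto simp: atLeast0LessThan)
  from kei_transport[OF assms(1) this] show ?thesis
    by (fastforce simp: keis_def)
qed

lemma finite_kei_classes: "finite (keis n // kei_iso_rel n)"
proof -
  let ?F = "{f. \<forall>u v. (u < n \<and> v < n \<longrightarrow> f u v \<in> {..<n}) \<and>
                (\<not> (u < n \<and> v < n) \<longrightarrow> f u v = (undefined :: nat))}"
  have "finite {h. \<forall>p. (p \<in> {..<n} \<times> {..<n} \<longrightarrow> h p \<in> {..<n}) \<and>
                (p \<notin> {..<n} \<times> {..<n} \<longrightarrow> h p = (undefined :: nat))}" (is "finite ?H")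
    by (rule finite_set_of_finite_funs) auto
  then have "finite (curry ` ?H)" by simp
  moreover have "?F \<subseteq> curry ` ?H"
  proof
    fix f assume "f \<in> ?F"
    then show "f \<in> curry ` ?H"
      by (intro image_eqI[of _ _ "case_prod f"]) auto
  qed
  ultimately have F: "finite ?F" by (rule finite_subset[rotated])
  have "keis n // kei_iso_rel n \<subseteq> (\<lambda>g. kei_iso_rel n `` {({..<n}, g)}) ` ?F"
  proof
    fix C assume "C \<in> keis n // kei_iso_rel n"
    then obtain X f where C: "C = kei_iso_rel n `` {(X, f)}" and Xf: "(X, f) \<in> keis n"
      by (auto elim: quotientE)
    then have k: "kei X f" "finite X" "card X = n" by (auto simp: keis_def)
    then obtain \<theta> where b: "bij_betw \<theta> X {..<n}"
      using ex_bij_betw_finite_nat[of X] by (auto simp: atLeast0LessThan)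
    define g where "g = (\<lambda>u v. if u \<in> {..<n} \<and> v \<in> {..<n}
      then \<theta> (f (inv_into X \<theta> u) (inv_into X \<theta> v)) else undefined)"
    have g: "kei {..<n} g" "rack_iso \<theta> X f {..<n} g"
      unfolding g_def by (rule kei_transport[OF k(1) b])+
    have u: "g u v = undefined" if "\<not> (u < n \<and> v < n)" for u v
      using that by (auto simp: g_def)
    have "((X, f), ({..<n}, g)) \<in> kei_iso_rel n"
      using Xf g by (auto simp: kei_iso_rel_def keis_def)
    then have "C = kei_iso_rel n `` {({..<n}, g)}"
      using C equiv_class_eq[OF equiv_kei_iso_rel] by auto
    moreover have "g \<in> ?F"
      using u rack.closed[OF kei_is_rack[OF g(1)]] by auto
    ultimately show "C \<in> (\<lambda>g. kei_iso_rel n `` {({..<n}, g)}) ` ?F" by blast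
  qed
  then show ?thesis using F finite_surj by blast
qed

end

theory Submission
  imports Defs "HOL-Library.FuncSet"
begin

text \<open>
  Split \<open>{..<n}\<close> into \<open>m = n div 2\<close> pairs \<open>{2 * i, 2 * i + 1}\<close>, leaving one fixed point if \<open>n\<close>
  is odd. For any \<open>m \<times> m\<close> zero-one matrix with zero diagonal, let the elements of pair \<open>j\<close> act by
  swapping the two elements of every pair \<open>i\<close> whose entry \<open>(i, j)\<close> is 1. The actions commute and
  are constant on pairs, so this is a kei, and it determines the matrix. An isomorphism class
  contains at most \<open>n ^ n\<close> of these \<open>2 ^ (m * (m - 1))\<close> kei.
\<close>

definition flip :: "nat \<Rightarrow> nat" where
  "flip x = (if even x then x + 1 else x - 1)"

lemma flip_div_2 [simp]: "flip x div 2 = x div 2"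
  by (auto simp: flip_def elim!: oddE)

lemma flip_flip [simp]: "flip (flip x) = x"
  by (auto simp: flip_def)

lemma flip_neq [simp]: "flip x \<noteq> x"
  by (auto simp: flip_def elim!: oddE)

text \<open>The bound is on \<open>x div 2\<close> because for odd \<open>n\<close> the point
  \<open>n - 1\<close> has no partner below \<open>n\<close>.\<close>

lemma flip_less: "x div 2 < n div 2 \<Longrightarrow> flip x < n"
  by (auto simp: flip_def elim!: oddE evenE)

definition pair_op :: "(nat \<times> nat) set \<Rightarrow> nat \<Rightarrow> nat \<Rightarrow> nat" where
  "pair_op S x y = (if (x div 2, y div 2) \<in> S then flip x else x)"

text \<open>A zero-one matrix is encoded as the set of positions of its ones. The diagonal is left
  out because a pair that swaps itself would violate idempotence.\<close>

definition off_diag :: "nat \<Rightarrow> (nat \<times> nat) set" where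
  "off_diag m = (SIGMA i:{..<m}. {..<m} - {i})"

lemma finite_off_diag: "finite (off_diag m)"
  by (simp add: off_diag_def)

lemma card_off_diag: "card (off_diag m) = m * (m - 1)"
  by (simp add: off_diag_def card_SigmaI)

text \<open>Self-distributivity holds because \<open>flip\<close> preserves \<open>x div 2\<close>:
  both sides test the same two entries of \<open>S\<close> and apply the resulting flips to
  \<open>x\<close> in opposite orders.\<close>

lemma kei_pair_op:
  assumes "S \<subseteq> off_diag (n div 2)"
  shows "kei {..<n} (pair_op S)"
proof -
  have cl: "pair_op S x y \<in> {..<n}" if "x \<in> {..<n}" for x y
    using assms that by (auto simp: pair_op_def off_diag_def intro!: flip_less)
  have inv: "pair_op S (pair_op S x y) y = x" for x y
    by (simp add: pair_op_def)
  show ?thesis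
  proof unfold_locales
    show "bij_betw (\<lambda>x. pair_op S x y) {..<n} {..<n}" for y
      by (intro bij_betw_byWitness[where f' = "\<lambda>x. pair_op S x y"]) (use cl inv in auto)
    show "pair_op S x x = x" for x
      using assms by (auto simp: pair_op_def off_diag_def)
  qed (use cl inv in \<open>auto simp: pair_op_def\<close>)
qed

lemma pair_op_in_keis: "S \<subseteq> off_diag (n div 2) \<Longrightarrow> ({..<n}, pair_op S) \<in> keis n"
  by (simp add: keis_def kei_pair_op)

text \<open>An isomorphism carries \<open>pair_op S\<close> over to \<open>pair_op T\<close>, so
  \<open>S\<close> and the isomorphism determine \<open>T\<close>. Counting all self-maps instead of
  the permutations is good enough.\<close>

lemma card_isomorphic_pair_op_le:
  assumes S: "S \<subseteq> off_diag (n div 2)"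
  shows "card {T \<in> Pow (off_diag (n div 2)).
           \<exists>\<theta>. rack_iso \<theta> {..<n} (pair_op S) {..<n} (pair_op T)} \<le> n ^ n"
    (is "card ?F \<le> _")
proof -
  let ?M = "{..<n} \<rightarrow>\<^sub>E {..<n}"
  \<comment> \<open>\<open>D p\<close> reads off the matrix of the operation transported along
    \<open>p\<close>: the entry at \<open>(i, j)\<close> is 1 exactly when \<open>2 * j\<close>
    moves \<open>2 * i\<close>.\<close>
  define D where "D p = {(i, j) \<in> off_diag (n div 2).
    p (pair_op S (inv_into {..<n} p (2 * i)) (inv_into {..<n} p (2 * j))) \<noteq> 2 * i}" for p
  have "?F \<subseteq> D ` ?M"
  proof
    fix T assume "T \<in> ?F"
    then obtain \<theta> where T: "T \<subseteq> off_diag (n div 2)"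
      and iso: "rack_iso \<theta> {..<n} (pair_op S) {..<n} (pair_op T)" by auto
    \<comment> \<open>Values of \<open>\<theta>\<close> outside the carrier are arbitrary;
      restricting puts the map into the finite set \<open>?M\<close>.\<close>
    define p where "p = restrict \<theta> {..<n}"
    have b: "bij_betw p {..<n} {..<n}"
      using iso by (simp add: p_def rack_iso_def)
    have hom: "pair_op T (p x) (p y) = p (pair_op S x y)" if "x < n" "y < n" for x y
      using that iso rack.closed[OF kei_is_rack[OF kei_pair_op[OF S]]]
      by (simp add: p_def rack_iso_def)
    have "pair_op T u v = p (pair_op S (inv_into {..<n} p u) (inv_into {..<n} p v))"
      if "u < n" "v < n" for u v
      using hom[of "inv_into {..<n} p u" "inv_into {..<n} p v"] that b
        bij_betw_inv_into[OF b]
      by (auto simp: bij_betw_inv_into_right dest: bij_betwE)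
    then have "D p = {(i, j) \<in> off_diag (n div 2). pair_op T (2 * i) (2 * j) \<noteq> 2 * i}"
      by (auto simp: D_def off_diag_def)
    also have "\<dots> = T"
      using T by (auto simp: pair_op_def)
    finally have "T = D p" ..
    moreover have "p \<in> ?M"
      using b by (auto simp: p_def bij_betw_def)
    ultimately show "T \<in> D ` ?M" by blast
  qed
  then have "card ?F \<le> card ?M"
    by (intro surj_card_le) (auto intro: finite_PiE)
  then show ?thesis by (simp add: card_PiE)
qed

text \<open>Double counting: the matrices are distributed over the isomorphism classes, and any
  matrix in a fibre serves as the reference \<open>S\<close> that bounds the size of that
  fibre.\<close>

lemma two_power_le_f_kei:
  fixes n :: nat
  defines "m \<equiv> n div 2"
  shows "2 ^ (m * (m - 1)) \<le> f_kei n * n ^ n"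
proof -
  define cls where "cls S = kei_iso_rel n `` {({..<n}, pair_op S)}" for S
  let ?A = "Pow (off_diag m)" and ?Q = "keis n // kei_iso_rel n"
  have cls: "cls S \<in> ?Q" if "S \<in> ?A" for S
    using that by (auto simp: cls_def m_def intro!: quotientI pair_op_in_keis)
  have fibre: "card {T \<in> ?A. cls T = c} \<le> n ^ n" for c
  proof (cases "\<exists>S\<in>?A. cls S = c")
    case True
    then obtain S where S: "S \<in> ?A" and c: "cls S = c" by blast
    have "{T \<in> ?A. cls T = c} \<subseteq>
        {T \<in> ?A. \<exists>\<theta>. rack_iso \<theta> {..<n} (pair_op S) {..<n} (pair_op T)}"
    proof safe
      fix T assume "T \<subseteq> off_diag m" "c = cls T"
      then have "(({..<n}, pair_op S), ({..<n}, pair_op T)) \<in> kei_iso_rel n"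
        using c eq_equiv_class[OF _ equiv_kei_iso_rel, of n] pair_op_in_keis
        by (auto simp: cls_def m_def)
      then show "\<exists>\<theta>. rack_iso \<theta> {..<n} (pair_op S) {..<n} (pair_op T)"
        by (simp add: kei_iso_rel_def)
    qed
    then have "card {T \<in> ?A. cls T = c} \<le>
        card {T \<in> ?A. \<exists>\<theta>. rack_iso \<theta> {..<n} (pair_op S) {..<n} (pair_op T)}"
      by (intro card_mono) (auto simp: finite_off_diag)
    also have "\<dots> \<le> n ^ n"
      using S card_isomorphic_pair_op_le[of S n] by (simp add: m_def)
    finally show ?thesis .
  next
    case False
    then have "{T \<in> ?A. cls T = c} = {}" by blast
    then show ?thesis by (simp only: card.empty)
  qed
  have "2 ^ (m * (m - 1)) = card ?A"
    by (simp add: card_Pow finite_off_diag card_off_diag)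
  also have "?A = (\<Union>c\<in>?Q. {T \<in> ?A. cls T = c})"
    using cls by blast
  also have "card \<dots> \<le> (\<Sum>c\<in>?Q. card {T \<in> ?A. cls T = c})"
    by (intro card_UN_le finite_kei_classes)
  also have "\<dots> \<le> f_kei n * n ^ n"
    using sum_bounded_above[of ?Q, OF fibre] by (simp add: f_kei_def)
  finally show ?thesis .
qed

theorem theorem7:
  "\<exists>C::real. C > 0 \<and>
     (\<forall>\<^sub>F n::nat in sequentially.
        real (f_kei n) \<ge> 2 powr ((1/4) * real n ^ 2 - C * real n * log 2 (real n)))"
\<comment> \<open>Of the constant 2, one \<open>n * log 2 n\<close> pays for the factor
  \<open>n ^ n\<close>, the other for the linear loss in
  \<open>m * (m - 1) \<ge> n ^ 2 / 4 - n\<close>.\<close>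
proof (intro exI[of _ 2] conjI eventually_sequentiallyI[of 3])
  fix n :: nat assume n: "3 \<le> n"
  define m where "m = n div 2"
  have m1: "m \<ge> 1" and "n \<le> 2 * m + 1"
    using n unfolding m_def by linarith+
  from this(2) have "real n \<le> real (2 * m + 1)"
    by (rule of_nat_mono)
  then have m: "real m \<ge> 1" "real m \<ge> (real n - 1) / 2"
    using m1 by simp_all
  have log: "log 2 (real n) \<ge> 1"
    using n by (simp add: le_log_iff)
  \<comment> \<open>Here \<open>3 \<le> n\<close> makes the second factor on the left
    nonnegative.\<close>
  have "(real n - 1) / 2 * ((real n - 1) / 2 - 1) \<le> real m * (real m - 1)"
    using m n by (intro mult_mono) auto
  then have "real n ^ 2 / 4 - real n \<le> real (m * (m - 1))"
    using m1 by (simp add: of_nat_diff field_simps power2_eq_square)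
  moreover have "real n \<le> real n * log 2 (real n)"
    using log n by simp
  ultimately have "2 powr ((1/4) * real n ^ 2 - 2 * real n * log 2 (real n))
      \<le> 2 powr (real (m * (m - 1)) - real n * log 2 (real n))"
    by (intro powr_mono) auto
  also have "\<dots> = 2 ^ (m * (m - 1)) / real n ^ n"
  proof -
    have "2 powr (real n * log 2 (real n)) = (2 powr log 2 (real n)) powr real n"
      by (simp add: powr_powr mult.commute)
    also have "\<dots> = real n ^ n"
      using n by (simp add: powr_realpow)
    finally show ?thesis
      by (simp only: powr_diff powr_realpow zero_less_numeral)
  qed
  also have "\<dots> \<le> real (f_kei n)"
  proof -
    have "real (2 ^ (m * (m - 1))) \<le> real (f_kei n * n ^ n)"
      using two_power_le_f_kei[of n] unfolding m_def of_nat_le_iff .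
    then show ?thesis
      using n by (simp add: divide_le_eq)
  qed
  finally show "2 powr ((1/4) * real n ^ 2 - 2 * real n * log 2 (real n)) \<le> real (f_kei n)" .
qed simp

end
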